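(* Let $n\ge2$, let $\rho$ be a real-analytic function on an open set $\widetilde\Omega\subset\mathbb{R}^{2n}$, let $y\mapsto A_J(y)$ be a real-analytic map from $\widetilde\Omega$ to the real $2n\times2n$ matrices with $A_J(y)^2=-I$ for all $y$ (an almost complex structure $J$), and let $a,b$ be real-analytic functions on an open set $\Omega\subset\mathbb{R}^2$ with $b$ nowhere zero (defining the almost complex structure on $\Omega$ with matrix $\begin{pmatrix}a&b\\-\frac{1+a^2}{b}&-a\end{pmatrix}$). Let $$\mathcal{A}=\frac{b}{1+a^2}\,(aI-A_J),$$ and let all objects in the context ($D$, $\mathfrak{D}_0$, $\gamma^1_i$, $\gamma^2_i$, the tableau $A^{(0)}$, the torsion coefficients $c^k_{1,2}$) be formed from $\rho$ and this $\mathcal{A}=(\alpha_{j,i})$. Then at every point of $M$ at which $D\ne0$: $\mathfrak{D}_0=0$; consequently $A^{(0)}$ is involutive; and the torsion can be absorbed if $$c^1_{1,2}=\sum_{i=3}^{2n}\gamma^1_ic^i_{1,2}\quad\text{and}\quad c^2_{1,2}=\sum_{i=3}^{2n}\gamma^2_ic^i_{1,2}.$$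
   Context: A map $f:\Omega\to\widetilde\Omega$ is almost holomorphic for the two structures exactly when $\partial f/\partial x_2=\mathcal{A}\,\partial f/\partial x_1$, with $A_J$ evaluated at $f(x)$ and $a,b$ at $x$; the problem behind these objects is the PDE system consisting of this equation and $\rho(f(x))=0$. Functions are evaluated at $x=(x_1,x_2)$ and $y=f=(f_1,\dots,f_{2n})$. Write $\rho_j=\partial\rho/\partial y_j$, let $\alpha^{(2)}_{j,i}$ be the entries of $\mathcal{A}^2$, and for $1\le i\le 2n$ put $$\mu_i=\sum_{j=1}^{2n}\rho_j\alpha_{j,i},\qquad \mu^{(2)}_i=\sum_{j=1}^{2n}\rho_j\alpha^{(2)}_{j,i}.$$ Put $D=\rho_1\mu_2-\rho_2\mu_1$, assumed nonzero. For $3\le i\le 2n$ and $1\le j\le 2n$ put $$\gamma^1_i=-\tfrac1D(\rho_i\mu_2-\rho_2\mu_i),\qquad \gamma^2_i=-\tfrac1D(\rho_1\mu_i-\rho_i\mu_1),\qquad \beta_{j,i}=\alpha_{j,1}\gamma^1_i+\alpha_{j,2}\gamma^2_i+\alpha_{j,i}.$$ Let $\mathfrak{D}_0=(\mathfrak{D}_{0,3},\dots,\mathfrak{D}_{0,2n})$ be the row vector with $$\mathfrak{D}_{0,i}=-\frac1{D^2}\Big\{\rho_1\big[\mu_i\mu^{(2)}_2-\mu_2\mu^{(2)}_i\big]+\rho_2\big[\mu_1\mu^{(2)}_i-\mu_i\mu^{(2)}_1\big]+\rho_i\big[\mu_2\mu^{(2)}_1-\mu_1\mu^{(2)}_2\big]\Big\}.$$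 Tableau: let $e_1,\dots,e_{2n}$ be the standard basis of $\mathbb{R}^{2n}$ and, for the tableau only, let $x_1,x_2$ denote the coordinate linear forms on $\mathbb{R}^2$. For $3\le j\le 2n$ let $$U_j=-\Big[\gamma^1_j\,e_1\otimes x_1+\gamma^2_j\,e_2\otimes x_1+e_j\otimes x_1+\sum_{i=1}^{2n}\beta_{i,j}\,e_i\otimes x_2\Big],$$ and let $A^{(0)}$ be the span of $U_3,\dots,U_{2n}$. Let $A^{(1)}$ be the space of $\mathbb{R}^{2n}$-valued homogeneous quadratic polynomials $P$ in $x_1,x_2$ with $\partial P/\partial x_1,\partial P/\partial x_2\in A^{(0)}$, and $A_1=\{P\in A^{(0)}:\partial P/\partial x_1=0\}$. $A^{(0)}$ is called involutive if $\dim A^{(1)}=\dim A^{(0)}+\dim A_1$. Torsion: let $M$ be the space with coordinates $(x_1,x_2,f_1,\dots,f_{2n},p^3_1,\dots,p^{2n}_1)$, with $(x_1,x_2)\in\Omega$, $f\in\widetilde\Omega$, $p^j_1\in\mathbb{R}$ (where $D\neq0$). On $M$ consider the 1-forms $$\theta^1=df_1-\sum_{j=3}^{2n}\gamma^1_jp^j_1dx_1-\sum_{j=3}^{2n}\beta_{1,j}p^j_1dx_2,\qquad \theta^2=df_2-\sum_{j=3}^{2n}\gamma^2_jp^j_1dx_1-\sum_{j=3}^{2n}\beta_{2,j}p^j_1dx_2,$$ $$\theta^i=df_i-p^i_1dx_1-\sum_{j=3}^{2n}\beta_{i,j}p^j_1dx_2\qquad(3\le i\le 2n).$$ Modulo the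 algebraic ideal generated by $\theta^1,\dots,\theta^{2n}$, each $d\theta^k$ is uniquely a combination of the forms $dp^j_1\wedge dx_1$, $dp^j_1\wedge dx_2$ ($3\le j\le 2n$) and $dx_1\wedge dx_2$; $c^k_{1,2}$ denotes the coefficient of $dx_1\wedge dx_2$. The torsion can be absorbed at a point of $M$ if there exist real numbers $v^i_1,v^i_2$ ($3\le i\le 2n$) such that at that point $$\sum_{i=3}^{2n}\big(\gamma^1_iv^i_2-\beta_{1,i}v^i_1\big)=c^1_{1,2},\qquad \sum_{i=3}^{2n}\big(\gamma^2_iv^i_2-\beta_{2,i}v^i_1\big)=c^2_{1,2},\qquad v^j_2-\sum_{i=3}^{2n}\beta_{j,i}v^i_1=c^j_{1,2}\quad(3\le j\le 2n).$$ *)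

theory Defs
  imports "HOL-Analysis.Analysis" "HOL-Library.Function_Algebras"
begin

section \<open>Functions as a real vector space\<close>

text \<open>The tableau and its prolongation are spaces of polynomial maps on \<open>\<real>\<^sup>2\<close>.  They are treated as
  subspaces of the space of all maps, so that \<open>span\<close> and \<open>dim\<close> apply.\<close>

instantiation "fun" :: (type, real_vector) real_vector
begin

definition scaleR_fun :: "real \<Rightarrow> ('a \<Rightarrow> 'b) \<Rightarrow> 'a \<Rightarrow> 'b" where
  "scaleR_fun c f = (\<lambda>x. c *\<^sub>R f x)"

instance
  by standard (simp_all add: scaleR_fun_def plus_fun_def fun_eq_iff algebra_simps)

end

section \<open>Real-analytic maps\<close>

text \<open>A multi-index is a function \<open>'k \<Rightarrow> nat\<close>; \<open>has_sum\<close> is unconditional summability over all of them.\<close>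

definition real_analytic_on ::
    "(real ^ 'k::finite \<Rightarrow> 'b::real_normed_vector) \<Rightarrow> (real ^ 'k) set \<Rightarrow> bool" where
  "real_analytic_on f S \<longleftrightarrow>
     (\<forall>x\<in>S. \<exists>r>0. \<exists>c :: ('k \<Rightarrow> nat) \<Rightarrow> 'b. \<forall>y\<in>ball x r.
        ((\<lambda>m. (\<Prod>i\<in>UNIV. (y $ i - x $ i) ^ m i) *\<^sub>R c m) has_sum f y) UNIV)"

section \<open>Index conventions\<close>

text \<open>\<open>\<real>\<^sup>2\<^sup>n\<close> is \<open>real ^ (2 + 'q)\<close> with \<open>CARD(2 + 'q) = 2 * n\<close>.  The left summand of the index type holds
  the indices \<open>1\<close> and \<open>2\<close>, the right summand \<open>'q\<close> the indices \<open>3, \<dots>, 2n\<close> (nothing depends on the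
  order of the latter).  So \<open>'q\<close> also indexes the fibre coordinates \<open>p\<^sup>3\<^sub>1, \<dots>, p\<^sup>2\<^sup>n\<^sub>1\<close>.
  The entry in row \<open>j\<close> and column \<open>i\<close> of a matrix is \<open>A $ j $ i\<close>.\<close>

abbreviation ix1 :: "2 + 'q" where "ix1 \<equiv> Inl 1"
abbreviation ix2 :: "2 + 'q" where "ix2 \<equiv> Inl 2"

section \<open>The pointwise algebraic objects\<close>

definition calA ::
    "(real ^ 2 \<Rightarrow> real) \<Rightarrow> (real ^ 2 \<Rightarrow> real) \<Rightarrow> (real ^ 'm::finite \<Rightarrow> real ^ 'm ^ 'm)
      \<Rightarrow> real ^ 2 \<Rightarrow> real ^ 'm \<Rightarrow> real ^ 'm ^ 'm" where
  "calA a b AJ x y = (b x / (1 + (a x)\<^sup>2)) *\<^sub>R (a x *\<^sub>R mat 1 - AJ y)"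

text \<open>The row \<open>(\<rho>\<^sub>1, \<dots>, \<rho>\<^sub>2\<^sub>n)\<close> of partial derivatives.\<close>

definition partials :: "(real ^ 'm::finite \<Rightarrow> real) \<Rightarrow> real ^ 'm \<Rightarrow> real ^ 'm" where
  "partials \<rho> y = (\<chi> j. frechet_derivative \<rho> (at y) (axis j 1))"

text \<open>Below \<open>r\<close> is the row of values \<open>\<rho>\<^sub>j\<close> and \<open>A\<close> the matrix of values \<open>\<alpha>\<^sub>j\<^sub>,\<^sub>i\<close> at the point
  under consideration.\<close>

definition mu :: "real ^ 'm::finite \<Rightarrow> real ^ 'm ^ 'm \<Rightarrow> 'm \<Rightarrow> real" where
  "mu r A i = (\<Sum>j\<in>UNIV. r $ j * A $ j $ i)"

definition mu2 :: "real ^ 'm::finite \<Rightarrow> real ^ 'm ^ 'm \<Rightarrow> 'm \<Rightarrow> real" where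
  "mu2 r A i = (\<Sum>j\<in>UNIV. r $ j * (A ** A) $ j $ i)"

definition Dden :: "real ^ (2 + 'q::finite) \<Rightarrow> real ^ (2 + 'q) ^ (2 + 'q) \<Rightarrow> real" where
  "Dden r A = r $ ix1 * mu r A ix2 - r $ ix2 * mu r A ix1"

definition gamma1 :: "real ^ (2 + 'q::finite) \<Rightarrow> real ^ (2 + 'q) ^ (2 + 'q) \<Rightarrow> 'q \<Rightarrow> real" where
  "gamma1 r A i = - (1 / Dden r A) * (r $ Inr i * mu r A ix2 - r $ ix2 * mu r A (Inr i))"

definition gamma2 :: "real ^ (2 + 'q::finite) \<Rightarrow> real ^ (2 + 'q) ^ (2 + 'q) \<Rightarrow> 'q \<Rightarrow> real" where
  "gamma2 r A i = - (1 / Dden r A) * (r $ ix1 * mu r A (Inr i) - r $ Inr i * mu r A ix1)"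

definition beta ::
    "real ^ (2 + 'q::finite) \<Rightarrow> real ^ (2 + 'q) ^ (2 + 'q) \<Rightarrow> 2 + 'q \<Rightarrow> 'q \<Rightarrow> real" where
  "beta r A j i = A $ j $ ix1 * gamma1 r A i + A $ j $ ix2 * gamma2 r A i + A $ j $ Inr i"

definition frakD0 :: "real ^ (2 + 'q::finite) \<Rightarrow> real ^ (2 + 'q) ^ (2 + 'q) \<Rightarrow> real ^ 'q" where
  "frakD0 r A = (\<chi> i. - (1 / (Dden r A)\<^sup>2) *
     (r $ ix1 * (mu r A (Inr i) * mu2 r A ix2 - mu r A ix2 * mu2 r A (Inr i)) +
      r $ ix2 * (mu r A ix1 * mu2 r A (Inr i) - mu r A (Inr i) * mu2 r A ix1) +
      r $ Inr i * (mu r A ix2 * mu2 r A ix1 - mu r A ix1 * mu2 r A ix2)))"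

section \<open>The tableau\<close>

text \<open>An element \<open>e \<otimes> \<phi>\<close> is the \<open>\<real>\<^sup>2\<^sup>n\<close>-valued linear form \<open>\<lambda>x. \<phi> x *\<^sub>R e\<close> on \<open>\<real>\<^sup>2\<close>.\<close>

definition tens :: "'v::real_vector \<Rightarrow> (real ^ 2 \<Rightarrow> real) \<Rightarrow> real ^ 2 \<Rightarrow> 'v" where
  "tens e \<phi> = (\<lambda>x. \<phi> x *\<^sub>R e)"

abbreviation cf1 :: "real ^ 2 \<Rightarrow> real" where "cf1 \<equiv> (\<lambda>x. x $ 1)"
abbreviation cf2 :: "real ^ 2 \<Rightarrow> real" where "cf2 \<equiv> (\<lambda>x. x $ 2)"

definition tabU ::
    "real ^ (2 + 'q::finite) \<Rightarrow> real ^ (2 + 'q) ^ (2 + 'q) \<Rightarrow> 'q \<Rightarrow> real ^ 2 \<Rightarrow> real ^ (2 + 'q)" where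
  "tabU r A j =
     - (gamma1 r A j *\<^sub>R tens (axis ix1 1) cf1 + gamma2 r A j *\<^sub>R tens (axis ix2 1) cf1
        + tens (axis (Inr j) 1) cf1 + (\<Sum>i\<in>UNIV. beta r A i j *\<^sub>R tens (axis i 1) cf2))"

definition tableau ::
    "real ^ (2 + 'q::finite) \<Rightarrow> real ^ (2 + 'q) ^ (2 + 'q) \<Rightarrow> (real ^ 2 \<Rightarrow> real ^ (2 + 'q)) set" where
  "tableau r A = span (range (tabU r A))"

definition pderiv_at :: "2 \<Rightarrow> (real ^ 2 \<Rightarrow> 'v::real_normed_vector) \<Rightarrow> real ^ 2 \<Rightarrow> 'v" where
  "pderiv_at k P = (\<lambda>x. frechet_derivative P (at x) (axis k 1))"

definition homogeneous_quadratic :: "(real ^ 2 \<Rightarrow> 'v::real_vector) \<Rightarrow> bool" where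
  "homogeneous_quadratic P \<longleftrightarrow>
     (\<exists>q11 q12 q22. P = (\<lambda>x. (x $ 1)\<^sup>2 *\<^sub>R q11 + (x $ 1 * x $ 2) *\<^sub>R q12 + (x $ 2)\<^sup>2 *\<^sub>R q22))"

definition prolongation ::
    "(real ^ 2 \<Rightarrow> 'v::real_normed_vector) set \<Rightarrow> (real ^ 2 \<Rightarrow> 'v) set" where
  "prolongation T = {P. homogeneous_quadratic P \<and> pderiv_at 1 P \<in> T \<and> pderiv_at 2 P \<in> T}"

definition tableau_kernel ::
    "(real ^ 2 \<Rightarrow> 'v::real_normed_vector) set \<Rightarrow> (real ^ 2 \<Rightarrow> 'v) set" where
  "tableau_kernel T = {P \<in> T. pderiv_at 1 P = (\<lambda>x. 0)}"

definition involutive :: "(real ^ 2 \<Rightarrow> 'v::real_normed_vector) set \<Rightarrow> bool" where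
  "involutive T \<longleftrightarrow> dim (prolongation T) = dim T + dim (tableau_kernel T)"

section \<open>The exterior differential system and its torsion\<close>

text \<open>Points \<open>(x, f, p)\<close> of the space \<open>M\<close>, and tangent vectors \<open>(dx, df, dp)\<close> to it.\<close>

type_synonym 'q jet = "(real ^ 2) \<times> (real ^ (2 + 'q)) \<times> (real ^ 'q)"

definition jet_space ::
    "(real ^ 2) set \<Rightarrow> (real ^ (2 + 'q::finite)) set \<Rightarrow> (real ^ (2 + 'q) \<Rightarrow> real)
      \<Rightarrow> (real ^ 2 \<Rightarrow> real ^ (2 + 'q) \<Rightarrow> real ^ (2 + 'q) ^ (2 + 'q)) \<Rightarrow> 'q jet set" where
  "jet_space \<Omega> \<Omega>' \<rho> AA = {(x, f, p). x \<in> \<Omega> \<and> f \<in> \<Omega>' \<and> Dden (partials \<rho> f) (AA x f) \<noteq> 0}"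

text \<open>A 1-form assigns to each point a linear functional on tangent vectors.  The conventions are
  \<open>(\<eta> \<and> \<theta>)(u, v) = \<eta>(u) \<theta>(v) - \<eta>(v) \<theta>(u)\<close> and \<open>d\<omega>(u, v) = D\<^sub>u(\<omega>(v)) - D\<^sub>v(\<omega>(u))\<close> for constant
  vector fields \<open>u, v\<close>, so that \<open>d(g dh) = dg \<and> dh\<close>.\<close>

definition wedge :: "('e \<Rightarrow> real) \<Rightarrow> ('e \<Rightarrow> real) \<Rightarrow> 'e \<Rightarrow> 'e \<Rightarrow> real" where
  "wedge \<eta> \<theta> u v = \<eta> u * \<theta> v - \<eta> v * \<theta> u"

definition ext_d :: "('e::real_normed_vector \<Rightarrow> 'e \<Rightarrow> real) \<Rightarrow> 'e \<Rightarrow> 'e \<Rightarrow> 'e \<Rightarrow> real" where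
  "ext_d \<omega> z u v =
     frechet_derivative (\<lambda>z'. \<omega> z' v) (at z) u - frechet_derivative (\<lambda>z'. \<omega> z' u) (at z) v"

definition dx_form :: "2 \<Rightarrow> 'q::finite jet \<Rightarrow> real" where
  "dx_form k = (\<lambda>(dx, df, dp). dx $ k)"

definition df_form :: "2 + 'q \<Rightarrow> 'q::finite jet \<Rightarrow> real" where
  "df_form k = (\<lambda>(dx, df, dp). df $ k)"

definition dp_form :: "'q \<Rightarrow> 'q::finite jet \<Rightarrow> real" where
  "dp_form j = (\<lambda>(dx, df, dp). dp $ j)"

definition theta ::
    "(real ^ (2 + 'q::finite) \<Rightarrow> real) \<Rightarrow> (real ^ 2 \<Rightarrow> real ^ (2 + 'q) \<Rightarrow> real ^ (2 + 'q) ^ (2 + 'q))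
      \<Rightarrow> 2 + 'q \<Rightarrow> 'q jet \<Rightarrow> 'q jet \<Rightarrow> real" where
  "theta \<rho> AA k = (\<lambda>(x, f, p) v.
     let r = partials \<rho> f; A = AA x f in
       df_form k v
       - (case k of
            Inl l \<Rightarrow> (\<Sum>j\<in>UNIV. (if l = 1 then gamma1 r A j else gamma2 r A j) * p $ j)
          | Inr i \<Rightarrow> p $ i) * dx_form 1 v
       - (\<Sum>j\<in>UNIV. beta r A k j * p $ j) * dx_form 2 v)"

text \<open>\<open>c\<close> is a coefficient of \<open>dx\<^sub>1 \<and> dx\<^sub>2\<close> in \<open>d\<theta>\<^sup>k\<close> at \<open>z\<close> modulo the algebraic ideal generated by
  \<open>\<theta>\<^sup>1, \<dots>, \<theta>\<^sup>2\<^sup>n\<close>; the 2-forms in that ideal are the sums of \<open>\<eta>\<^sub>l \<and> \<theta>\<^sup>l\<close>.\<close>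

definition is_torsion_coeff ::
    "(real ^ (2 + 'q::finite) \<Rightarrow> real) \<Rightarrow> (real ^ 2 \<Rightarrow> real ^ (2 + 'q) \<Rightarrow> real ^ (2 + 'q) ^ (2 + 'q))
      \<Rightarrow> 'q jet \<Rightarrow> 2 + 'q \<Rightarrow> real \<Rightarrow> bool" where
  "is_torsion_coeff \<rho> AA z k c \<longleftrightarrow>
     (\<exists>(s :: 'q \<Rightarrow> real) (t :: 'q \<Rightarrow> real) (\<eta> :: 2 + 'q \<Rightarrow> 'q jet \<Rightarrow> real).
        (\<forall>l. linear (\<eta> l)) \<and>
        (\<forall>u v. ext_d (theta \<rho> AA k) z u v =
           (\<Sum>j\<in>UNIV. s j * wedge (dp_form j) (dx_form 1) u v)
           + (\<Sum>j\<in>UNIV. t j * wedge (dp_form j) (dx_form 2) u v)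
           + c * wedge (dx_form 1) (dx_form 2) u v
           + (\<Sum>l\<in>UNIV. wedge (\<eta> l) (theta \<rho> AA l z) u v)))"

definition torsion_coeff ::
    "(real ^ (2 + 'q::finite) \<Rightarrow> real) \<Rightarrow> (real ^ 2 \<Rightarrow> real ^ (2 + 'q) \<Rightarrow> real ^ (2 + 'q) ^ (2 + 'q))
      \<Rightarrow> 'q jet \<Rightarrow> 2 + 'q \<Rightarrow> real" where
  "torsion_coeff \<rho> AA z k = (THE c. is_torsion_coeff \<rho> AA z k c)"

lemma linear_functional_split:
  fixes L :: "'q::finite jet \<Rightarrow> real" and g h :: "2 + 'q \<Rightarrow> real"
  assumes L: "linear L"
  defines "th \<equiv> \<lambda>l v. df_form l v - g l * dx_form 1 v - h l * dx_form 2 v"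
  shows "\<exists>a b1 b2 e. \<forall>v. L v = (\<Sum>j\<in>UNIV. a j * dp_form j v) + b1 * dx_form 1 v
           + b2 * dx_form 2 v + (\<Sum>l\<in>UNIV. e l * th l v)"
proof -
  define e where "e l = L (0, axis l 1, 0)" for l
  define a where "a j = L (0, 0, axis j 1)" for j
  define d where "d k = L (axis k 1, 0, 0)" for k :: 2
  have ex: "w = (\<Sum>i\<in>UNIV. (w $ i) *\<^sub>R axis i 1)" for w :: "real ^ 'k::finite"
    by (simp add: vec_eq_iff axis_def if_distrib[of "\<lambda>t. _ * t"] cong: if_cong)
  have lin: "linear (\<lambda>w. L (w, 0, 0))" "linear (\<lambda>w. L (0, w, 0))" "linear (\<lambda>w. L (0, 0, w))"
    using linear_add[OF L, of "(_, 0, 0)" "(_, 0, 0)"] linear_scale[OF L, of _ "(_, 0, 0)"]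
      linear_add[OF L, of "(0, _, 0)" "(0, _, 0)"] linear_scale[OF L, of _ "(0, _, 0)"]
      linear_add[OF L, of "(0, 0, _)" "(0, 0, _)"] linear_scale[OF L, of _ "(0, 0, _)"]
    by (simp_all add: linear_iff)
  have "L v = (\<Sum>j\<in>UNIV. a j * dp_form j v) + (d 1 + (\<Sum>l\<in>UNIV. e l * g l)) * dx_form 1 v
          + (d 2 + (\<Sum>l\<in>UNIV. e l * h l)) * dx_form 2 v + (\<Sum>l\<in>UNIV. e l * th l v)" for v
  proof (cases v)
    case (fields dx df dp)
    have "L v = L (dx, 0, 0) + L (0, df, 0) + L (0, 0, dp)"
      by (simp add: fields flip: linear_add[OF L])
    moreover have "L (dx, 0, 0) = d 1 * dx $ 1 + d 2 * dx $ 2"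
      by (subst ex[of dx], subst linear_sum[OF lin(1)])
         (simp add: sum_2 linear_scale[OF lin(1)] d_def mult.commute)
    moreover have "L (0, df, 0) = (\<Sum>l\<in>UNIV. e l * df $ l)"
      by (subst ex[of df], subst linear_sum[OF lin(2)])
         (simp add: linear_scale[OF lin(2)] e_def mult.commute)
    moreover have "L (0, 0, dp) = (\<Sum>j\<in>UNIV. a j * dp $ j)"
      by (subst ex[of dp], subst linear_sum[OF lin(3)])
         (simp add: linear_scale[OF lin(3)] a_def mult.commute)
    ultimately show ?thesis
      by (simp add: fields th_def dx_form_def df_form_def dp_form_def algebra_simps
          sum.distrib sum_subtractf sum_distrib_left sum_distrib_right)
  qed
  then show ?thesis by blast
qed

text \<open>The coefficient exists and is unique as soon as the coefficient functions are differentiable.\<close>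

lemma torsion_coeff_well_defined:
  fixes \<rho> :: "real ^ (2 + 'q::finite) \<Rightarrow> real"
  assumes "\<And>j. (\<lambda>(x, f). gamma1 (partials \<rho> f) (AA x f) j) differentiable at (x, f)"
    and "\<And>j. (\<lambda>(x, f). gamma2 (partials \<rho> f) (AA x f) j) differentiable at (x, f)"
    and "\<And>k j. (\<lambda>(x, f). beta (partials \<rho> f) (AA x f) k j) differentiable at (x, f)"
  shows "\<exists>!c. is_torsion_coeff \<rho> AA (x, f, p) k c"
proof -
  define g where "g k = (\<lambda>(x, f, p). case k of
      Inl l \<Rightarrow> (\<Sum>j\<in>UNIV. (if l = 1 then gamma1 (partials \<rho> f) (AA x f) j
                           else gamma2 (partials \<rho> f) (AA x f) j) * p $ j)
    | Inr i \<Rightarrow> p $ i)" for k :: "2 + 'q"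
  define h where "h k = (\<lambda>(x, f, p). \<Sum>j\<in>UNIV. beta (partials \<rho> f) (AA x f) k j * p $ j)"
    for k :: "2 + 'q"
  let ?z = "(x, f, p)"
  have th: "theta \<rho> AA l z v = df_form l v - g l z * dx_form 1 v - h l z * dx_form 2 v" for l z v
    by (cases z) (simp add: theta_def g_def h_def Let_def)
  have proj: "(\<lambda>z :: 'q jet. (fst z, fst (snd z))) differentiable at ?z"
    by (intro bounded_linear_imp_differentiable bounded_linear_intros)
  have lift: "(\<lambda>z. F (fst z, fst (snd z))) differentiable at ?z"
    if "F differentiable at (x, f)" for F :: "_ \<Rightarrow> real"
    using differentiable_chain_at[OF proj, of F] that by (simp add: o_def)
  have pj: "(\<lambda>z :: 'q jet. snd (snd z) $ j) differentiable at ?z" for j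
    by (intro bounded_linear_imp_differentiable bounded_linear_compose[OF bounded_linear_vec_nth]
        bounded_linear_intros)
  have gd: "g k differentiable at ?z"
  proof (cases k)
    case (Inl l)
    then show ?thesis
      using lift[OF assms(1)] lift[OF assms(2)] pj
      by (cases "l = 1") (auto simp: g_def case_prod_unfold intro!: differentiable_sum differentiable_mult)
  next
    case (Inr i)
    then show ?thesis using pj by (simp add: g_def case_prod_unfold)
  qed
  have hd: "h k differentiable at ?z"
    using lift[OF assms(3)] pj
    by (auto simp: h_def case_prod_unfold intro!: differentiable_sum differentiable_mult)
  define g' where "g' = frechet_derivative (g k) (at ?z)"
  define h' where "h' = frechet_derivative (h k) (at ?z)"
  have dg: "(g k has_derivative g') (at ?z)" and dh: "(h k has_derivative h') (at ?z)"
    using gd hd by (simp_all add: g'_def h'_def frechet_derivative_works[symmetric])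
  have "((\<lambda>z. theta \<rho> AA k z v) has_derivative
          (\<lambda>w. 0 - g' w * dx_form 1 v - h' w * dx_form 2 v)) (at ?z)" for v
    unfolding th by (intro has_derivative_diff has_derivative_const has_derivative_mult_left dg dh)
  then have fd: "frechet_derivative (\<lambda>z. theta \<rho> AA k z v) (at ?z) =
      (\<lambda>w. 0 - g' w * dx_form 1 v - h' w * dx_form 2 v)" for v
    by (rule frechet_derivative_at[symmetric])
  have dth: "ext_d (theta \<rho> AA k) ?z u v =
      - wedge g' (dx_form 1) u v - wedge h' (dx_form 2) u v" for u v
    by (simp add: ext_d_def fd wedge_def algebra_simps)
  obtain a1 b11 b12 e1 where g': "\<forall>v. g' v = (\<Sum>j\<in>UNIV. a1 j * dp_form j v)
      + b11 * dx_form 1 v + b12 * dx_form 2 v + (\<Sum>l\<in>UNIV. e1 l * theta \<rho> AA l ?z v)"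
    using linear_functional_split[OF has_derivative_linear[OF dg], of "\<lambda>l. g l ?z" "\<lambda>l. h l ?z"]
    unfolding th[symmetric] by blast
  obtain a2 b21 b22 e2 where h': "\<forall>v. h' v = (\<Sum>j\<in>UNIV. a2 j * dp_form j v)
      + b21 * dx_form 1 v + b22 * dx_form 2 v + (\<Sum>l\<in>UNIV. e2 l * theta \<rho> AA l ?z v)"
    using linear_functional_split[OF has_derivative_linear[OF dh], of "\<lambda>l. g l ?z" "\<lambda>l. h l ?z"]
    unfolding th[symmetric] by blast
  define \<eta> where "\<eta> l v = e1 l * dx_form 1 v + e2 l * dx_form 2 v" for l and v :: "'q jet"
  have lin: "linear (\<eta> l)" for l
    by (intro linearI) (auto simp: \<eta>_def dx_form_def algebra_simps)
  have "is_torsion_coeff \<rho> AA ?z k (b12 - b21)"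
    unfolding is_torsion_coeff_def
  proof (rule exI[of _ "\<lambda>j. - a1 j"], rule exI[of _ "\<lambda>j. - a2 j"], rule exI[of _ \<eta>],
      intro conjI allI lin)
    fix u v
    show "ext_d (theta \<rho> AA k) ?z u v =
        (\<Sum>j\<in>UNIV. - a1 j * wedge (dp_form j) (dx_form 1) u v)
      + (\<Sum>j\<in>UNIV. - a2 j * wedge (dp_form j) (dx_form 2) u v)
      + (b12 - b21) * wedge (dx_form 1) (dx_form 2) u v
      + (\<Sum>l\<in>UNIV. wedge (\<eta> l) (theta \<rho> AA l ?z) u v)"
    proof -
      have pull: "(\<Sum>i\<in>UNIV. - c i * wedge (F i) G u v) =
          (\<Sum>i\<in>UNIV. c i * F i v) * G u - (\<Sum>i\<in>UNIV. c i * F i u) * G v"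
        for c :: "'q \<Rightarrow> real" and F :: "'q \<Rightarrow> 'q jet \<Rightarrow> real" and G
        unfolding wedge_def sum_distrib_right sum_subtractf[symmetric]
        by (intro sum.cong refl) algebra
      have pull_eta: "(\<Sum>l\<in>UNIV. wedge (\<eta> l) (F l) u v) =
          ((\<Sum>l\<in>UNIV. e1 l * F l v) * dx_form 1 u - (\<Sum>l\<in>UNIV. e1 l * F l u) * dx_form 1 v)
          + ((\<Sum>l\<in>UNIV. e2 l * F l v) * dx_form 2 u - (\<Sum>l\<in>UNIV. e2 l * F l u) * dx_form 2 v)"
        for F :: "2 + 'q \<Rightarrow> 'q jet \<Rightarrow> real"
        unfolding wedge_def \<eta>_def sum_distrib_right sum_subtractf[symmetric] sum.distrib[symmetric]
        by (intro sum.cong refl) algebra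
      show ?thesis
        unfolding dth pull pull_eta unfolding wedge_def g'[rule_format] h'[rule_format] by algebra
    qed
  qed
  moreover have "c = c'" if "is_torsion_coeff \<rho> AA ?z k c" "is_torsion_coeff \<rho> AA ?z k c'" for c c'
  proof -
    let ?u = "(axis 1 1, \<chi> l. g l ?z, 0) :: 'q jet"
    let ?v = "(axis 2 1, \<chi> l. h l ?z, 0) :: 'q jet"
    have "ext_d (theta \<rho> AA k) ?z ?u ?v = c" if "is_torsion_coeff \<rho> AA ?z k c" for c
      using that by (auto simp: is_torsion_coeff_def wedge_def th dx_form_def df_form_def
          dp_form_def axis_def)
    then show ?thesis using that by metis
  qed
  ultimately show ?thesis by blast
qed

definition torsion_absorbable ::
    "(real ^ (2 + 'q::finite) \<Rightarrow> real) \<Rightarrow> (real ^ 2 \<Rightarrow> real ^ (2 + 'q) \<Rightarrow> real ^ (2 + 'q) ^ (2 + 'q))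
      \<Rightarrow> 'q jet \<Rightarrow> bool" where
  "torsion_absorbable \<rho> AA z \<longleftrightarrow>
     (case z of (x, f, p) \<Rightarrow>
       let r = partials \<rho> f; A = AA x f; c = torsion_coeff \<rho> AA z in
       \<exists>v1 v2 :: 'q \<Rightarrow> real.
         (\<Sum>i\<in>UNIV. gamma1 r A i * v2 i - beta r A ix1 i * v1 i) = c ix1 \<and>
         (\<Sum>i\<in>UNIV. gamma2 r A i * v2 i - beta r A ix2 i * v1 i) = c ix2 \<and>
         (\<forall>j. v2 j - (\<Sum>i\<in>UNIV. beta r A (Inr j) i * v1 i) = c (Inr j)))"

end

theory Submission
  imports Defs
begin

text \<open>
  All three claims are linear algebra at a fixed point.  The source of the first two is that
  \<open>A = (b / (1 + a\<^sup>2)) (a I - J)\<close> is an affine function of \<open>J\<close>, so that \<open>J\<^sup>2 = -I\<close> turns into a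
  quadratic relation \<open>A\<^sup>2 = t A + d I\<close> (\<open>calA_squared\<close>).

  Multiplying this relation by the row \<open>r\<close> of partial derivatives of \<open>\<rho>\<close> shows that the row
  \<open>\<mu>\<^sup>(\<^sup>2\<^sup>)\<close> is a linear combination of \<open>\<mu>\<close> and \<open>r\<close>.  Up to the factor \<open>-1 / D\<^sup>2\<close>, the entry \<open>i\<close> of
  \<open>\<DD>\<^sub>0\<close> is the minor of the rows \<open>r, \<mu>, \<mu>\<^sup>(\<^sup>2\<^sup>)\<close> on the columns \<open>1, 2, i\<close>, hence it vanishes.

  For the tableau, consider the space \<open>W\<close> of the vectors killed by both \<open>r\<close> and \<open>\<mu>\<close>.
  Cramer's rule with the determinant \<open>D\<close> expresses the first two coordinates of a vector in \<open>W\<close> by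
  the others; the coefficients are exactly the \<open>\<gamma>\<^sup>1\<^sub>i\<close> and \<open>\<gamma>\<^sup>2\<^sub>i\<close>.  Therefore the tableau is
  the set of the linear maps \<open>x\<^sub>1 v + x\<^sub>2 A v\<close> with \<open>v \<in> W\<close> (\<open>tableau_eq\<close>).  A quadratic map
  whose first partial derivatives have this shape must be
  \<open>x\<^sub>1\<^sup>2 v + 2 x\<^sub>1 x\<^sub>2 A v + x\<^sub>2\<^sup>2 A\<^sup>2 v\<close> with \<open>v\<close> and \<open>A v\<close> in \<open>W\<close>.  The quadratic relation
  makes \<open>W\<close> invariant under \<open>A\<close>, so the second condition is automatic, and the prolongation has
  dimension \<open>dim W\<close>, like the tableau itself.  Since \<open>v\<close> is the derivative along \<open>x\<^sub>1\<close> of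
  \<open>x\<^sub>1 v + x\<^sub>2 A v\<close>, the space \<open>A\<^sub>1\<close> is zero, and the equation for involutivity holds.

  Under the two conditions on the torsion coefficients, \<open>v\<^sub>1 = 0\<close> and \<open>v\<^sub>2\<^sup>j = c\<^sup>j\<^sub>1\<^sub>,\<^sub>2\<close> absorb the
  torsion.
\<close>

section \<open>The quadratic relation and the vanishing of the obstruction\<close>

text \<open>With \<open>s = b / (1 + a\<^sup>2)\<close>, so \<open>A = s (a I - J)\<close>, the relation \<open>J\<^sup>2 = -I\<close> gives
  \<open>A\<^sup>2 = s\<^sup>2 ((a\<^sup>2 - 1) I - 2 a J)\<close>, and \<open>s J = s a I - A\<close> eliminates \<open>J\<close> from this.\<close>

lemma calA_squared:
  fixes AJ :: "real ^ 'm::finite \<Rightarrow> real ^ 'm ^ 'm"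
  assumes J: "AJ y ** AJ y = - mat 1"
  shows "\<exists>t d. calA a b AJ x y ** calA a b AJ x y = t *\<^sub>R calA a b AJ x y + d *\<^sub>R mat 1"
proof -
  define s where "s = b x / (1 + (a x)\<^sup>2)"
  define A where "A = calA a b AJ x y"
  have A: "A *v v = s *\<^sub>R (a x *\<^sub>R v - AJ y *v v)" for v
    by (simp add: A_def calA_def s_def algebra_simps flip: scaleR_matrix_vector_assoc)
  have JJ: "AJ y *v (AJ y *v v) = - v" for v
    by (simp add: matrix_vector_mul_assoc J) (simp add: vec_eq_iff matrix_vector_mult_def mat_def
        if_distrib if_distribR sum_negf cong: if_cong)
  have "(A ** A) *v v = ((2 * a x * s) *\<^sub>R A + (- (s\<^sup>2 * (1 + (a x)\<^sup>2))) *\<^sub>R mat 1) *v v" for v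
  proof -
    have AAv: "(A ** A) *v v = A *v (A *v v)"
      by (simp add: matrix_vector_mul_assoc)
    have lin: "(t *\<^sub>R A + d *\<^sub>R mat 1) *v v = t *\<^sub>R (A *v v) + d *\<^sub>R v" for t d
      by (simp add: matrix_vector_mult_add_rdistrib flip: scaleR_matrix_vector_assoc)
    show ?thesis
      unfolding AAv lin A
      by (simp add: matrix_vector_mult_scaleR matrix_vector_mult_diff_distrib JJ)
        (simp add: vec_eq_iff algebra_simps power2_eq_square)
  qed
  then have "A ** A = (2 * a x * s) *\<^sub>R A + (- (s\<^sup>2 * (1 + (a x)\<^sup>2))) *\<^sub>R mat 1"
    unfolding matrix_eq by blast
  then show ?thesis
    unfolding A_def[symmetric] by blast
qed

lemma mu_eq: "mu r A i = (r v* A) $ i"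
  by (simp add: mu_def vector_matrix_mult_def mult.commute)

lemma mu2_quadratic:
  assumes "A ** A = t *\<^sub>R A + d *\<^sub>R mat 1"
  shows "mu2 r A i = t * mu r A i + d * r $ i"
  by (simp add: mu2_def mu_def assms mat_def distrib_left sum.distrib sum_distrib_left mult_ac
      if_distrib[of "(*) _"] cong: if_cong)

text \<open>The bracket in \<open>frakD0\<close> is alternating in the three rows \<open>r\<close>, \<open>mu\<close>, \<open>mu2\<close>, and the quadratic
  relation makes them linearly dependent.\<close>

lemma frakD0_eq_0:
  assumes "A ** A = t *\<^sub>R A + d *\<^sub>R mat 1"
  shows "frakD0 r A = 0"
  by (simp add: vec_eq_iff frakD0_def mu2_quadratic[OF assms] algebra_simps)

section \<open>The tableau as a space of symbols\<close>

text \<open>The space \<open>W\<close>.  Its second equation is that \<open>v\<close> is killed by the row \<open>mu r A\<close>, written so that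
  the action of \<open>A\<close> on the space is visible.\<close>

definition annih :: "real ^ 'm::finite \<Rightarrow> real ^ 'm ^ 'm \<Rightarrow> (real ^ 'm) set" where
  "annih r A = {v. r \<bullet> v = 0 \<and> r \<bullet> (A *v v) = 0}"

text \<open>For constant \<open>A\<close>, the linear solution of \<open>\<partial>f/\<partial>x\<^sub>2 = A \<partial>f/\<partial>x\<^sub>1\<close> with \<open>\<partial>f/\<partial>x\<^sub>1 = v\<close>.\<close>

definition symbol :: "real ^ 'm ^ 'm \<Rightarrow> real ^ 'm::finite \<Rightarrow> real ^ 2 \<Rightarrow> real ^ 'm" where
  "symbol A v = (\<lambda>x. (x $ 1) *\<^sub>R v + (x $ 2) *\<^sub>R (A *v v))"

text \<open>The coefficient of \<open>x\<^sub>1\<close> in \<open>- tabU r A j\<close>.\<close>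

definition frame ::
    "real ^ (2 + 'q::finite) \<Rightarrow> real ^ (2 + 'q) ^ (2 + 'q) \<Rightarrow> 'q \<Rightarrow> real ^ (2 + 'q)" where
  "frame r A j = gamma1 r A j *\<^sub>R axis ix1 1 + gamma2 r A j *\<^sub>R axis ix2 1 + axis (Inr j) 1"

lemma subspace_annih: "subspace (annih r A)"
  by (auto simp: annih_def subspace_def inner_add_right matrix_vector_right_distrib
      matrix_vector_mult_scaleR)

lemma annih_invariant:
  assumes "A ** A = t *\<^sub>R A + d *\<^sub>R mat 1" "v \<in> annih r A"
  shows "A *v v \<in> annih r A"
proof -
  have "A *v (A *v v) = t *\<^sub>R (A *v v) + d *\<^sub>R v"
    by (simp add: matrix_vector_mul_assoc assms(1) matrix_vector_mult_add_rdistrib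
        flip: scaleR_matrix_vector_assoc)
  with assms(2) show ?thesis
    by (simp add: annih_def inner_add_right)
qed

lemma sum_UNIV_two_plus:
  "(\<Sum>i\<in>UNIV. g i) = g ix1 + g ix2 + (\<Sum>j\<in>UNIV. g (Inr j))"
  for g :: "2 + 'q::finite \<Rightarrow> real"
  by (simp flip: UNIV_Plus_UNIV add: sum.Plus sum_2)

lemma all_two_plus: "(\<forall>i. P i) \<longleftrightarrow> P ix1 \<and> P ix2 \<and> (\<forall>j. P (Inr j))"
  by (metis exhaust_2 sum.exhaust)

lemma mem_annih_iff:
  "v \<in> annih r A \<longleftrightarrow>
     r $ ix1 * v $ ix1 + r $ ix2 * v $ ix2 + (\<Sum>j\<in>UNIV. r $ Inr j * v $ Inr j) = 0 \<and>
     mu r A ix1 * v $ ix1 + mu r A ix2 * v $ ix2 + (\<Sum>j\<in>UNIV. mu r A (Inr j) * v $ Inr j) = 0"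
  for r :: "real ^ (2 + 'q::finite)"
  unfolding annih_def mem_Collect_eq dot_lmul_matrix[symmetric]
  by (simp add: mu_eq inner_vec_def sum_UNIV_two_plus)

lemma frame_nth:
  "frame r A j $ ix1 = gamma1 r A j" "frame r A j $ ix2 = gamma2 r A j"
  "frame r A j $ Inr i = (if i = j then 1 else 0)"
  by (auto simp: frame_def axis_def)

text \<open>Cramer's rule for the two equations that define \<open>annih r A\<close>, solved for the coordinates
  \<open>ix1\<close> and \<open>ix2\<close>: this is where the coefficients \<open>gamma1\<close> and \<open>gamma2\<close> come from.\<close>

lemma span_frame:
  assumes D: "Dden r A \<noteq> 0"
  shows "span (range (frame r A)) = annih r A"
proof
  have "frame r A j \<in> annih r A" for j
  proof -
    have "r $ ix1 * gamma1 r A j + r $ ix2 * gamma2 r A j + r $ Inr j = 0"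
      "mu r A ix1 * gamma1 r A j + mu r A ix2 * gamma2 r A j + mu r A (Inr j) = 0"
      using D by (simp_all add: gamma1_def gamma2_def field_simps) (simp_all add: Dden_def algebra_simps)
    then show ?thesis
      by (simp add: mem_annih_iff frame_nth if_distrib cong: if_cong)
  qed
  then show "span (range (frame r A)) \<subseteq> annih r A"
    by (intro span_minimal subspace_annih) auto
next
  show "annih r A \<subseteq> span (range (frame r A))"
  proof
    fix v assume v: "v \<in> annih r A"
    define R where "R = (\<Sum>j\<in>UNIV. r $ Inr j * v $ Inr j)"
    define M where "M = (\<Sum>j\<in>UNIV. mu r A (Inr j) * v $ Inr j)"
    have eqs: "r $ ix1 * v $ ix1 + r $ ix2 * v $ ix2 + R = 0"
      "mu r A ix1 * v $ ix1 + mu r A ix2 * v $ ix2 + M = 0"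
      using v by (simp_all add: mem_annih_iff R_def M_def)
    have cramer: "S = z" if "S = - (1 / Dden r A) * X" "z * Dden r A = - X" for S z X
    proof -
      have "z = - X / Dden r A"
        using that(2) by (simp only: nonzero_eq_divide_eq[OF D])
      with that(1) show ?thesis by simp
    qed
    have "(\<Sum>j\<in>UNIV. v $ Inr j * gamma1 r A j) = - (1 / Dden r A) * (R * mu r A ix2 - r $ ix2 * M)"
      by (simp add: gamma1_def R_def M_def sum_distrib_left sum_distrib_right sum_subtractf
          right_diff_distrib sum_negf mult_ac)
    moreover have "v $ ix1 * Dden r A = - (R * mu r A ix2 - r $ ix2 * M)"
      using eqs unfolding Dden_def by algebra
    ultimately have v1: "(\<Sum>j\<in>UNIV. v $ Inr j * gamma1 r A j) = v $ ix1"
      by (rule cramer)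
    have "(\<Sum>j\<in>UNIV. v $ Inr j * gamma2 r A j) = - (1 / Dden r A) * (r $ ix1 * M - R * mu r A ix1)"
      by (simp add: gamma2_def R_def M_def sum_distrib_left sum_distrib_right sum_subtractf
          right_diff_distrib sum_negf mult_ac)
    moreover have "v $ ix2 * Dden r A = - (r $ ix1 * M - R * mu r A ix1)"
      using eqs unfolding Dden_def by algebra
    ultimately have v2: "(\<Sum>j\<in>UNIV. v $ Inr j * gamma2 r A j) = v $ ix2"
      by (rule cramer)
    have "v = (\<Sum>j\<in>UNIV. (v $ Inr j) *\<^sub>R frame r A j)"
      unfolding vec_eq_iff
      by (subst all_two_plus) (simp add: frame_nth v1 v2 if_distrib cong: if_cong)
    also have "\<dots> \<in> span (range (frame r A))"
      by (intro span_sum span_scale span_base) auto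
    finally show "v \<in> span (range (frame r A))" .
  qed
qed

lemma linear_symbol: "linear (symbol A)"
  by (rule linearI) (simp_all add: symbol_def fun_eq_iff scaleR_fun_def algebra_simps)

lemma inj_symbol: "inj (symbol A)"
proof (rule injI)
  fix v w assume "symbol A v = symbol A w"
  then have "symbol A v (axis 1 1) = symbol A w (axis 1 1)"
    by simp
  then show "v = w"
    by (simp add: symbol_def axis_def)
qed

lemma sum_fun_apply: "(\<Sum>i\<in>I. F i) x = (\<Sum>i\<in>I. F i x)"
  by (induction I rule: infinite_finite_induct) auto

lemma tabU_eq: "tabU r A j = - symbol A (frame r A j)"
proof -
  have "beta r A k j = (A *v frame r A j) $ k" for k
    by (simp add: beta_def matrix_vector_mult_def sum_UNIV_two_plus frame_nth if_distrib cong: if_cong)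
  then have "(\<Sum>i\<in>UNIV. beta r A i j *\<^sub>R axis i 1) = A *v frame r A j"
    by (simp add: vec_eq_iff axis_def if_distrib cong: if_cong)
  then have "(\<Sum>i\<in>UNIV. beta r A i j *\<^sub>R t *\<^sub>R axis i 1) = t *\<^sub>R (A *v frame r A j)" for t
    by (simp add: scaleR_sum_right mult.commute flip: \<open>_ = A *v frame r A j\<close>)
  then show ?thesis
    by (simp add: tabU_def symbol_def fun_eq_iff scaleR_fun_def tens_def sum_fun_apply)
      (simp add: frame_def algebra_simps)
qed

lemma tableau_eq:
  assumes "Dden r A \<noteq> 0"
  shows "tableau r A = symbol A ` annih r A"
proof -
  have "range (tabU r A) = symbol A ` uminus ` range (frame r A)"
    by (simp add: image_image tabU_eq linear_neg[OF linear_symbol])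
  moreover have "uminus ` annih r A = annih r A"
    using subspace_neg[OF subspace_annih] by (force simp: image_iff)
  ultimately show ?thesis
    unfolding tableau_def
    by (simp add: linear_span_image[OF linear_symbol] linear_span_image[OF linear_uminus]
        span_frame[OF assms])
qed

section \<open>Involutivity\<close>

text \<open>The homogeneous quadratic solution of the same system with second derivative \<open>2 v\<close> along
  \<open>x\<^sub>1\<close>.\<close>

definition quad_symbol :: "real ^ 'm ^ 'm \<Rightarrow> real ^ 'm::finite \<Rightarrow> real ^ 2 \<Rightarrow> real ^ 'm" where
  "quad_symbol A v =
     (\<lambda>x. (x $ 1)\<^sup>2 *\<^sub>R v + (2 * x $ 1 * x $ 2) *\<^sub>R (A *v v) + (x $ 2)\<^sup>2 *\<^sub>R (A *v (A *v v)))"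

lemma linear_quad_symbol: "linear (quad_symbol A)"
  by (rule linearI) (simp_all add: quad_symbol_def fun_eq_iff scaleR_fun_def algebra_simps)

lemma inj_quad_symbol: "inj (quad_symbol A)"
proof (rule injI)
  fix v w assume "quad_symbol A v = quad_symbol A w"
  then have "quad_symbol A v (axis 1 1) = quad_symbol A w (axis 1 1)"
    by simp
  then show "v = w"
    by (simp add: quad_symbol_def axis_def)
qed

lemma pderiv_at_symbol: "pderiv_at 1 (symbol A v) = (\<lambda>x. v)"
proof
  fix x
  have "(symbol A v has_derivative (\<lambda>h. (h $ 1) *\<^sub>R v + (h $ 2) *\<^sub>R (A *v v))) (at x)"
    unfolding symbol_def
    by (intro bounded_linear_imp_has_derivative bounded_linear_add
        bounded_linear_compose[OF bounded_linear_scaleR_left bounded_linear_vec_nth])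
  from frechet_derivative_at[OF this, symmetric] show "pderiv_at 1 (symbol A v) x = v"
    by (simp add: pderiv_at_def axis_def)
qed

lemma pderiv_at_quadratic:
  fixes p q s :: "'v::real_normed_vector"
  defines "P \<equiv> \<lambda>x :: real ^ 2. (x $ 1)\<^sup>2 *\<^sub>R p + (x $ 1 * x $ 2) *\<^sub>R q + (x $ 2)\<^sup>2 *\<^sub>R s"
  shows "pderiv_at 1 P = (\<lambda>x. (x $ 1) *\<^sub>R (2 *\<^sub>R p) + (x $ 2) *\<^sub>R q)"
    and "pderiv_at 2 P = (\<lambda>x. (x $ 1) *\<^sub>R q + (x $ 2) *\<^sub>R (2 *\<^sub>R s))"
proof -
  have "frechet_derivative P (at x) = (\<lambda>h. (2 * x $ 1 * h $ 1) *\<^sub>R p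
      + (x $ 1 * h $ 2 + h $ 1 * x $ 2) *\<^sub>R q + (2 * x $ 2 * h $ 2) *\<^sub>R s)" for x
  proof (rule frechet_derivative_at[symmetric])
    have nth: "((\<lambda>x :: real ^ 2. x $ k) has_derivative (\<lambda>h. h $ k)) (at x)" for k
      by (intro bounded_linear_imp_has_derivative bounded_linear_vec_nth)
    show "(P has_derivative (\<lambda>h. (2 * x $ 1 * h $ 1) *\<^sub>R p
      + (x $ 1 * h $ 2 + h $ 1 * x $ 2) *\<^sub>R q + (2 * x $ 2 * h $ 2) *\<^sub>R s)) (at x)"
      unfolding P_def power2_eq_square
      by (rule has_derivative_eq_rhs, (rule derivative_intros nth)+)
        (simp add: fun_eq_iff algebra_simps)
  qed
  then show "pderiv_at 1 P = (\<lambda>x. (x $ 1) *\<^sub>R (2 *\<^sub>R p) + (x $ 2) *\<^sub>R q)"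
    and "pderiv_at 2 P = (\<lambda>x. (x $ 1) *\<^sub>R q + (x $ 2) *\<^sub>R (2 *\<^sub>R s))"
    by (simp_all add: pderiv_at_def axis_def fun_eq_iff mult_ac)
qed

lemma linear_form_mem_image_symbol:
  "(\<lambda>x. (x $ 1) *\<^sub>R p + (x $ 2) *\<^sub>R q) \<in> symbol A ` W \<longleftrightarrow> p \<in> W \<and> q = A *v p"
proof
  assume "(\<lambda>x. (x $ 1) *\<^sub>R p + (x $ 2) *\<^sub>R q) \<in> symbol A ` W"
  then obtain v where v: "v \<in> W" and eq: "\<And>x. (x $ 1) *\<^sub>R p + (x $ 2) *\<^sub>R q = symbol A v x"
    by (auto simp: fun_eq_iff)
  show "p \<in> W \<and> q = A *v p"
    using v eq[of "axis 1 1"] eq[of "axis 2 1"] by (simp add: symbol_def axis_def)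
qed (auto simp: symbol_def)

text \<open>If \<open>P\<close> has coefficients \<open>p, q, s\<close>, the two derivatives have coefficients \<open>(2 p, q)\<close> and
  \<open>(q, 2 s)\<close>, so \<open>p\<close> determines \<open>q = 2 A p\<close> and \<open>s = A\<^sup>2 p\<close>.  Conversely every \<open>p \<in> W\<close>
  occurs, because the remaining condition \<open>q \<in> W\<close> is the invariance of \<open>W\<close>.\<close>

lemma prolongation_symbol:
  assumes "subspace W" and inv: "\<And>v. v \<in> W \<Longrightarrow> A *v v \<in> W"
  shows "prolongation (symbol A ` W) = quad_symbol A ` W"
proof (intro set_eqI iffI)
  fix P assume "P \<in> prolongation (symbol A ` W)"
  then obtain p q s where P: "P = (\<lambda>x. (x $ 1)\<^sup>2 *\<^sub>R p + (x $ 1 * x $ 2) *\<^sub>R q + (x $ 2)\<^sup>2 *\<^sub>R s)"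
    and mem: "pderiv_at 1 P \<in> symbol A ` W" "pderiv_at 2 P \<in> symbol A ` W"
    unfolding prolongation_def homogeneous_quadratic_def by blast
  have p: "2 *\<^sub>R p \<in> W" and q: "q = A *v (2 *\<^sub>R p)" and s: "2 *\<^sub>R s = A *v q"
    using mem unfolding P pderiv_at_quadratic linear_form_mem_image_symbol by auto
  have "p \<in> W"
    using subspace_scale[OF assms(1) p, of "1/2"] by simp
  moreover have "s = A *v (A *v p)"
  proof -
    have "2 *\<^sub>R s = 2 *\<^sub>R (A *v (A *v p))"
      by (simp only: s q matrix_vector_mult_scaleR)
    then show ?thesis by simp
  qed
  then have "P = quad_symbol A p"
    by (simp add: P q quad_symbol_def matrix_vector_mult_scaleR mult_ac)
  ultimately show "P \<in> quad_symbol A ` W" by blast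
next
  fix P assume "P \<in> quad_symbol A ` W"
  then obtain v where v: "v \<in> W" and P: "P = (\<lambda>x. (x $ 1)\<^sup>2 *\<^sub>R v
      + (x $ 1 * x $ 2) *\<^sub>R (2 *\<^sub>R (A *v v)) + (x $ 2)\<^sup>2 *\<^sub>R (A *v (A *v v)))"
    by (auto simp: quad_symbol_def mult_ac)
  have "homogeneous_quadratic P"
    unfolding homogeneous_quadratic_def P by blast
  then show "P \<in> prolongation (symbol A ` W)"
    using v inv[OF v] unfolding prolongation_def mem_Collect_eq P pderiv_at_quadratic
      linear_form_mem_image_symbol
    by (simp add: matrix_vector_mult_scaleR subspace_scale[OF assms(1)])
qed

lemma tableau_kernel_symbol:
  assumes "subspace W"
  shows "tableau_kernel (symbol A ` W) = {0}"
proof -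
  have "tableau_kernel (symbol A ` W) = symbol A ` {0}"
    using subspace_0[OF assms] by (auto simp: tableau_kernel_def pderiv_at_symbol fun_eq_iff)
  then show ?thesis
    by (simp add: linear_0[OF linear_symbol])
qed

text \<open>The symbols and the quadratic symbols are both injective linear images of \<open>W\<close>.\<close>

lemma involutive_symbol:
  assumes "subspace W" and "\<And>v. v \<in> W \<Longrightarrow> A *v v \<in> W"
  shows "involutive (symbol A ` W)"
proof -
  have "dim (quad_symbol A ` W) = dim W" "dim (symbol A ` W) = dim W"
    by (auto intro!: eucl.dim_image_eq linear_quad_symbol linear_symbol
        intro: inj_on_subset[OF inj_quad_symbol] inj_on_subset[OF inj_symbol])
  moreover have "dim {0 :: real ^ 2 \<Rightarrow> real ^ 'a} = 0"
    using dim_span[of "{} :: (real ^ 2 \<Rightarrow> real ^ 'a) set"]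
      real_vector.dim_eq_card_independent[OF real_vector.independent_empty]
    by (metis card.empty span_empty)
  ultimately show ?thesis
    using assms by (simp add: involutive_def prolongation_symbol tableau_kernel_symbol)
qed

section \<open>Absorption of the torsion\<close>

text \<open>With \<open>v1 = 0\<close> the equations for the indices \<open>Inr j\<close> force \<open>v2 j = c (Inr j)\<close>, and those for
  \<open>ix1\<close> and \<open>ix2\<close> become the two hypotheses.\<close>

lemma torsion_absorbableI:
  fixes AA :: "real ^ 2 \<Rightarrow> real ^ (2 + 'q::finite) \<Rightarrow> real ^ (2 + 'q) ^ (2 + 'q)"
    and \<rho> :: "real ^ (2 + 'q) \<Rightarrow> real" and x f p
  defines "c \<equiv> torsion_coeff \<rho> AA (x, f, p)"
  assumes "c ix1 = (\<Sum>i\<in>UNIV. gamma1 (partials \<rho> f) (AA x f) i * c (Inr i))"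
    and "c ix2 = (\<Sum>i\<in>UNIV. gamma2 (partials \<rho> f) (AA x f) i * c (Inr i))"
  shows "torsion_absorbable \<rho> AA (x, f, p)"
  unfolding torsion_absorbable_def Let_def prod.case c_def[symmetric]
  by (rule exI[of _ "\<lambda>_. 0"], rule exI[of _ "\<lambda>j. c (Inr j)"]) (simp add: assms(2,3))

theorem corollary3p6:
  fixes n :: nat
    and \<Omega> :: "(real ^ 2) set"
    and \<Omega>' :: "(real ^ (2 + 'q::finite)) set"
    and \<rho> :: "real ^ (2 + 'q) \<Rightarrow> real"
    and AJ :: "real ^ (2 + 'q) \<Rightarrow> real ^ (2 + 'q) ^ (2 + 'q)"
    and a b :: "real ^ 2 \<Rightarrow> real"
  defines "AA \<equiv> calA a b AJ"
  assumes "n \<ge> 2" and "CARD(2 + 'q) = 2 * n"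
    and "open \<Omega>" and "open \<Omega>'"
    and "real_analytic_on \<rho> \<Omega>'"
    and "real_analytic_on AJ \<Omega>'"
    and "\<forall>y\<in>\<Omega>'. AJ y ** AJ y = - mat 1"
    and "real_analytic_on a \<Omega>" and "real_analytic_on b \<Omega>"
    and "\<forall>x\<in>\<Omega>. b x \<noteq> 0"
  shows "\<forall>(x, f, p) \<in> jet_space \<Omega> \<Omega>' \<rho> AA.
    let r = partials \<rho> f; A = AA x f; c = torsion_coeff \<rho> AA (x, f, p) in
      frakD0 r A = 0 \<and>
      involutive (tableau r A) \<and>
      (c ix1 = (\<Sum>i\<in>UNIV. gamma1 r A i * c (Inr i)) \<and>
       c ix2 = (\<Sum>i\<in>UNIV. gamma2 r A i * c (Inr i)) \<longrightarrow>
         torsion_absorbable \<rho> AA (x, f, p))"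
proof -
  have "frakD0 (partials \<rho> f) (AA x f) = 0 \<and> involutive (tableau (partials \<rho> f) (AA x f))"
    if "(x, f, p) \<in> jet_space \<Omega> \<Omega>' \<rho> AA" for x f and p :: "real ^ 'q"
  proof -
    have f: "f \<in> \<Omega>'" and D: "Dden (partials \<rho> f) (AA x f) \<noteq> 0"
      using that by (auto simp: jet_space_def)
    obtain t d where sq: "AA x f ** AA x f = t *\<^sub>R AA x f + d *\<^sub>R mat 1"
      using calA_squared assms(8) f unfolding AA_def by blast
    show ?thesis
      unfolding tableau_eq[OF D]
      using frakD0_eq_0[OF sq] involutive_symbol[OF subspace_annih annih_invariant[OF sq]] by blast
  qed
  then show ?thesis
    unfolding Let_def using torsion_absorbableI[of \<rho> AA] by blast
qed

end
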